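(* Let $d\ge2$ be an integer. The generic $f\in\mathrm{Homeo}([0,1]^d)$ is nowhere differentiable; that is, the set of those $f\in\mathrm{Homeo}([0,1]^d)$ which are not differentiable at any point $x\in[0,1]^d$ is co-meager.
   Context: $\mathrm{Homeo}([0,1]^d)$ is the group of homeomorphisms of $[0,1]^d$ with the topology of the maximum metric $\max_x|f(x)-g(x)|$ ($|\cdot|$ the Euclidean norm); this topology is completely metrizable. A set is meager if it is a countable union of nowhere dense sets, and co-meager if its complement is meager. A map $f\colon[0,1]^d\to\mathbb{R}^d$ is differentiable at $x_0\in[0,1]^d$ if there is a $d\times d$ matrix $L$ with $\lim_{x\to x_0,\,x\in[0,1]^d}\frac{|f(x)-f(x_0)-L(x-x_0)|}{|x-x_0|}=0$. *)

theory Defs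
  imports "HOL-Analysis.Analysis"
begin

definition nowhere_dense_in :: "'a topology \<Rightarrow> 'a set \<Rightarrow> bool" where
  "nowhere_dense_in X S \<longleftrightarrow> S \<subseteq> topspace X \<and> X interior_of (X closure_of S) = {}"

definition meager_in :: "'a topology \<Rightarrow> 'a set \<Rightarrow> bool" where
  "meager_in X S \<longleftrightarrow> (\<exists>\<N>. countable \<N> \<and> (\<forall>N\<in>\<N>. nowhere_dense_in X N) \<and> S = \<Union>\<N>)"

definition comeager_in :: "'a topology \<Rightarrow> 'a set \<Rightarrow> bool" where
  "comeager_in X S \<longleftrightarrow> S \<subseteq> topspace X \<and> meager_in X (topspace X - S)"

definition unit_cube :: "(real ^ 'n) set" where
  "unit_cube = {x. \<forall>i. 0 \<le> x $ i \<and> x $ i \<le> 1}"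

text \<open>A homeomorphism of the cube is represented by the function on the whole type that agrees
  with it on the cube and is \<^const>\<open>undefined\<close> elsewhere, so that each homeomorphism has exactly
  one representative. The metric is inherited from the library's space of bounded continuous
  functions, whose elements are extensional in this sense and whose metric is the
  supremum metric.\<close>

definition Homeo_cube :: "(real ^ 'n \<Rightarrow> real ^ 'n) metric" where
  "Homeo_cube =
     submetric (cfunspace (top_of_set unit_cube) euclidean_metric)
       {f. homeomorphic_map (top_of_set unit_cube) (top_of_set unit_cube) f}"

lemma unit_cube_eq_cbox: "unit_cube = cbox 0 (1 :: real ^ 'n)"
  by (auto simp: unit_cube_def mem_box_cart)

lemma mspace_Homeo_cube:
  "mspace (Homeo_cube :: (real ^ 'n \<Rightarrow> real ^ 'n) metric) =
     {f \<in> extensional unit_cube. \<exists>g. homeomorphism unit_cube unit_cube f g}"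
proof -
  have "bounded (f ` (unit_cube :: (real ^ 'n) set))"
    if "continuous_on unit_cube f" for f :: "real ^ 'n \<Rightarrow> real ^ 'n"
    using that by (simp add: unit_cube_eq_cbox compact_continuous_image compact_imp_bounded)
  moreover have "homeomorphic_map (top_of_set unit_cube) (top_of_set unit_cube) f \<longleftrightarrow>
      (\<exists>g. homeomorphism unit_cube unit_cube f g)" for f :: "real ^ 'n \<Rightarrow> real ^ 'n"
  proof -
    have "homeomorphic_maps (top_of_set unit_cube) (top_of_set unit_cube) f g \<longleftrightarrow>
        homeomorphism unit_cube unit_cube f g" for g
      unfolding homeomorphic_maps_def homeomorphism_def by (auto simp: Pi_iff image_iff) metis+
    then show ?thesis
      by (simp add: homeomorphic_map_maps)
  qed
  ultimately show ?thesis
    by (auto simp: Homeo_cube_def homeomorphism_def)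
qed

lemma mdist_Homeo_cube:
  fixes f g :: "real ^ 'n \<Rightarrow> real ^ 'n"
  assumes "f \<in> mspace Homeo_cube" "g \<in> mspace Homeo_cube"
  shows "mdist Homeo_cube f g = (SUP x\<in>unit_cube. norm (f x - g x))"
proof -
  have "(0 :: real ^ 'n) \<in> unit_cube"
    by (simp add: unit_cube_def)
  then have "(unit_cube :: (real ^ 'n) set) \<noteq> {}"
    by blast
  with assms show ?thesis
    by (simp add: Homeo_cube_def cfunspace_def Met_TC.fdist_def dist_norm)
qed

lemma differentiable_within_matrix:
  fixes f :: "real ^ 'n \<Rightarrow> real ^ 'm"
  shows "f differentiable (at a within S) \<longleftrightarrow>
    (\<exists>L :: real ^ 'n ^ 'm.
      ((\<lambda>x. norm (f x - f a - L *v (x - a)) / norm (x - a)) \<longlongrightarrow> 0) (at a within S))"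
proof -
  have "(\<exists>D. bounded_linear D \<and> P D) \<longleftrightarrow> (\<exists>L :: real ^ 'n ^ 'm. P ((*v) L))" (is "?A \<longleftrightarrow> ?B")
    for P :: "(real ^ 'n \<Rightarrow> real ^ 'm) \<Rightarrow> bool"
  proof
    assume ?A
    then obtain D where "bounded_linear D" "P D"
      by blast
    with matrix_vector_mul(3)[of D] have "P ((*v) (matrix D))"
      by simp
    then show ?B ..
  next
    assume ?B
    then show ?A
      using matrix_vector_mul_bounded_linear by blast
  qed
  then show ?thesis
    unfolding differentiable_def has_derivative_iff_norm .
qed

end

theory Submission
  imports Defs
begin

text \<open>A map that is differentiable at \<open>x\<close> satisfies a Lipschitz estimate at \<open>x\<close> in some
  ball, so it suffices that every homeomorphism \<open>f\<close> is close to a homeomorphism \<open>g\<close> for which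
  all points \<open>x\<close> have a point \<open>y\<close> at distance less than \<open>\<delta>\<close> with \<open>|g y - g x| \<ge> c\<close>, where
  \<open>c / \<delta>\<close> is as large as desired; the lower bound survives small perturbations of \<open>g\<close>. Take
  \<open>g = \<phi> \<circ> f\<close>, where \<open>\<phi>\<close> moves only one coordinate and oscillates fast, with fixed amplitude,
  in another one (hence \<open>d \<ge> 2\<close>). The wavelength of \<open>\<phi>\<close> is chosen after \<open>\<delta>\<close>, by uniform
  continuity of the inverse of \<open>f\<close>. To respect the boundary, \<open>\<phi>\<close> interpolates between two
  increasing homeomorphisms of \<open>[0,1]\<close> whose difference is \<open>a\<close> except very near the endpoints.\<close>

section \<open>Oscillating homeomorphisms of the cube\<close>

definition lift :: "real \<Rightarrow> real \<Rightarrow> real \<Rightarrow> real" where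
  "lift a K x = min (K * x) (a + (1 - a) * x)"

text \<open>The graph of \<open>lift a K\<close> reflected through the centre of the unit square:
  the steep piece of slope \<open>K\<close> sits at 1 instead of 0, and the long pieces of both
  graphs are parallel, of slope \<open>1 - a\<close>.\<close>

definition lower :: "real \<Rightarrow> real \<Rightarrow> real \<Rightarrow> real" where
  "lower a K x = 1 - lift a K (1 - x)"

text \<open>The weight \<open>sin\<^sup>2\<close> runs through all of \<open>[0,1]\<close> and has
  period \<open>1 / M\<close> in coordinate \<open>j\<close>; \<open>M\<close> sets the wavelength
  only and leaves the amplitude alone.\<close>

definition twist :: "'n \<Rightarrow> 'n \<Rightarrow> real \<Rightarrow> real \<Rightarrow> nat \<Rightarrow> real ^ 'n \<Rightarrow> real ^ 'n" where
  "twist i j a K M p = (\<chi> l. if l = i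
     then (1 - (sin (pi * M * p $ j))\<^sup>2) * lower a K (p $ i) + (sin (pi * M * p $ j))\<^sup>2 * lift a K (p $ i)
     else p $ l)"

lemma lift_strict_mono:
  assumes "0 < K" "a < 1" "x < y"
  shows "lift a K x < lift a K y"
proof -
  have "K * x < K * y" "(1 - a) * x < (1 - a) * y"
    using assms by simp_all
  then show ?thesis
    unfolding lift_def by linarith
qed

lemma lift_0: "0 \<le> a \<Longrightarrow> lift a K 0 = 0"
  and lift_1: "1 \<le> K \<Longrightarrow> lift a K 1 = 1"
  by (simp_all add: lift_def)

lemma lower_strict_mono:
  assumes "0 < K" "a < 1" "x < y"
  shows "lower a K x < lower a K y"
  using lift_strict_mono[of K a "1 - y" "1 - x"] assms by (simp add: lower_def)

lemma lift_bounds: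
  assumes "1 \<le> K" "0 \<le> a" "0 \<le> x" "x \<le> 1"
  shows "x \<le> lift a K x" "lift a K x \<le> x + a"
proof -
  have "1 * x \<le> K * x" "0 \<le> a * (1 - x)" "0 \<le> a * x"
    using assms by (intro mult_right_mono mult_nonneg_nonneg; simp)+
  then show "x \<le> lift a K x" "lift a K x \<le> x + a"
    by (simp_all add: lift_def algebra_simps min_le_iff_disj)
qed

lemma lower_bounds:
  assumes "1 \<le> K" "0 \<le> a" "0 \<le> x" "x \<le> 1"
  shows "x - a \<le> lower a K x" "lower a K x \<le> x"
  using lift_bounds[of K a "1 - x"] assms by (simp_all add: lower_def)

text \<open>For \<open>x\<close> in this range the minimum in \<open>lift\<close> is its second
  term, since \<open>K * x \<ge> 1\<close>; by reflection \<open>lower\<close> is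
  \<open>(1 - a) * x\<close> there.\<close>

lemma lift_minus_lower:
  assumes "0 < K" "0 \<le> a" "a < 1" "1 / K \<le> x" "x \<le> 1 - 1 / K"
  shows "lift a K x - lower a K x = a"
proof -
  have *: "lift a K y = a + (1 - a) * y" if "1 / K \<le> y" "y \<le> 1" for y
  proof -
    have "(1 - a) * y \<le> (1 - a) * 1"
      using that assms by (intro mult_left_mono) auto
    moreover have "1 \<le> K * y"
      using that assms by (simp add: field_simps)
    ultimately show ?thesis
      by (simp add: lift_def)
  qed
  have "0 < 1 / K"
    using assms by simp
  then have "x \<le> 1" "1 - x \<le> 1" "1 / K \<le> 1 - x"
    using assms by linarith+
  then show ?thesis
    using assms by (simp add: lower_def * algebra_simps)
qed

lemma continuous_on_lift:
  "continuous_on S f \<Longrightarrow> continuous_on S (\<lambda>x. lift a K (f x))"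
  unfolding lift_def by (intro continuous_intros)

lemma continuous_on_lower:
  "continuous_on S f \<Longrightarrow> continuous_on S (\<lambda>x. lower a K (f x))"
  unfolding lower_def by (intro continuous_intros continuous_on_lift)

lemma sin_squared_le_one: "(sin (x :: real))\<^sup>2 \<le> 1"
  by (simp add: abs_square_le_1)

lemma convex_combination_bounds:
  fixes t :: real
  assumes "0 \<le> t" "t \<le> 1" "l \<le> u" "u \<le> h" "l \<le> v" "v \<le> h"
  shows "l \<le> (1 - t) * u + t * v" "(1 - t) * u + t * v \<le> h"
  using convex_bound_le[of u h v "1 - t" t] convex_bound_le[of "- u" "- l" "- v" "1 - t" t] assms
  by simp_all

lemma continuous_on_twist: "continuous_on S (twist i j a K M)"
proof -
  have "continuous_on S (\<lambda>p. if l = i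
      then (1 - (sin (pi * M * p $ j))\<^sup>2) * lower a K (p $ i) + (sin (pi * M * p $ j))\<^sup>2 * lift a K (p $ i)
      else p $ l)" for l
    by (cases "l = i") (auto intro!: continuous_intros continuous_on_lift continuous_on_lower)
  then show ?thesis
    unfolding twist_def by (rule continuous_on_vec_lambda)
qed

lemma norm_axis: "norm (axis i x :: real ^ 'n::finite) = \<bar>x\<bar>"
proof -
  have "axis i x = x *\<^sub>R (axis i 1 :: real ^ 'n)"
    by (simp add: vec_eq_iff axis_def)
  then show ?thesis
    by simp
qed

text \<open>Only coordinate \<open>i\<close> moves, to a convex combination of two values within
  \<open>a\<close> of it.\<close>

lemma twist_displacement:
  assumes "1 \<le> K" "0 \<le> a" "p \<in> unit_cube"
  shows "norm (twist i j a K M p - p) \<le> a"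
proof -
  define s where "s = (twist i j a K M p - p) $ i"
  have p: "0 \<le> p $ i" "p $ i \<le> 1"
    using assms by (auto simp: unit_cube_def)
  have "p $ i - a \<le> twist i j a K M p $ i" "twist i j a K M p $ i \<le> p $ i + a"
    unfolding twist_def vec_lambda_beta if_P[OF refl]
    using convex_combination_bounds[OF zero_le_power2 sin_squared_le_one,
        of "p $ i - a" "lower a K (p $ i)" "p $ i + a" "lift a K (p $ i)"]
      lift_bounds[OF assms(1,2) p] lower_bounds[OF assms(1,2) p] assms(2)
    by (meson add_increasing2 diff_le_eq order_trans)+
  then have "\<bar>s\<bar> \<le> a"
    by (simp add: s_def)
  moreover have "twist i j a K M p - p = axis i s"
    by (simp add: s_def vec_eq_iff axis_def twist_def)
  ultimately show ?thesis
    by (simp add: norm_axis)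
qed

text \<open>The weight depends on coordinate \<open>j\<close> alone, which stays fixed. So every
  segment of the cube parallel to axis \<open>i\<close> is mapped onto itself by an increasing
  bijection, and a continuous bijection of a compact cube is a homeomorphism.\<close>

lemma homeomorphism_twist:
  fixes i j :: "'n::finite"
  assumes "1 \<le> K" "0 \<le> a" "a < 1" "i \<noteq> j"
  shows "\<exists>h. homeomorphism unit_cube unit_cube (twist i j a K M) h"
proof -
  define t where "t p = (sin (pi * M * p $ j))\<^sup>2" for p :: "real ^ 'n"
  define H where "H s x = (1 - s) * lower a K x + s * lift a K x" for s x
  have tw: "twist i j a K M p = (\<chi> l. if l = i then H (t p) (p $ i) else p $ l)" for p
    unfolding twist_def H_def t_def by (rule refl)
  have t01: "0 \<le> t p" "t p \<le> 1" for p
    by (simp_all add: t_def sin_squared_le_one)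
  have H_mono: "H s x < H s y" if "0 \<le> s" "s \<le> 1" "x < y" for s x y
  \<comment> \<open>Strictness has to come from a summand with positive weight: \<open>lower\<close>
    if \<open>s = 0\<close>, otherwise \<open>lift\<close>.\<close>
  proof (cases "s = 0")
    case True
    then show ?thesis
      using that assms by (simp add: H_def lower_strict_mono)
  next
    case False
    then show ?thesis
      unfolding H_def using that assms
      by (intro add_le_less_mono mult_left_mono mult_strict_left_mono
          less_imp_le[OF lower_strict_mono] lift_strict_mono) auto
  qed
  have H0: "H s 0 = 0" and H1: "H s 1 = 1" for s
    using assms by (simp_all add: H_def lower_def lift_0 lift_1)
  have H_le: "H s x \<le> H s y" if "0 \<le> s" "s \<le> 1" "x \<le> y" for s x y
    using H_mono[of s x y] that by (cases "x = y") auto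
  have into: "twist i j a K M p \<in> unit_cube" if "p \<in> unit_cube" for p
    using that H_le[OF t01, of 0 "p $ i" p] H_le[OF t01, of "p $ i" 1 p]
    by (auto simp: tw unit_cube_def H0 H1)
  have "p \<in> twist i j a K M ` unit_cube" if p: "p \<in> unit_cube" for p
  proof -
    have "\<exists>x\<ge>0. x \<le> 1 \<and> H (t p) x = p $ i"
    proof (rule IVT')
      show "continuous_on {0..1} (H (t p))"
        unfolding H_def by (intro continuous_intros continuous_on_lift continuous_on_lower)
    qed (use p in \<open>auto simp: H0 H1 unit_cube_def\<close>)
    then obtain x where x: "0 \<le> x" "x \<le> 1" "H (t p) x = p $ i"
      by blast
    \<comment> \<open>Changing coordinate \<open>i\<close> only keeps the weight, as
      \<open>i \<noteq> j\<close>.\<close>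
    define q where "q = (\<chi> l. if l = i then x else p $ l)"
    have "t q = t p"
      using assms by (simp add: t_def q_def)
    then have "twist i j a K M q = p"
      using x(3) by (simp add: tw vec_eq_iff q_def)
    moreover have "q \<in> unit_cube"
      using p x by (simp add: q_def unit_cube_def)
    ultimately show ?thesis
      by blast
  qed
  moreover have "inj_on (twist i j a K M) unit_cube"
  proof (rule inj_onI)
    fix p q :: "real ^ 'n"
    assume eq: "twist i j a K M p = twist i j a K M q"
    have other: "p $ l = q $ l" if "l \<noteq> i" for l
      using arg_cong[OF eq, of "\<lambda>v. v $ l"] that by (simp add: tw)
    then have "t p = t q"
      using assms by (simp add: t_def)
    then have "H (t p) (p $ i) = H (t p) (q $ i)"
      using arg_cong[OF eq, of "\<lambda>v. v $ i"] by (simp add: tw)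
    then have "p $ i = q $ i"
      using H_mono[OF t01, of "p $ i" "q $ i" p] H_mono[OF t01, of "q $ i" "p $ i" p]
      by (cases "p $ i" "q $ i" rule: linorder_cases) auto
    with other show "p = q"
      by (metis vec_eq_iff)
  qed
  ultimately show ?thesis
    using into
    by (intro homeomorphism_compact continuous_on_twist) (auto simp: unit_cube_eq_cbox)
qed

text \<open>Push coordinate \<open>i\<close> of \<open>p\<close> into the range where the gap is
  exactly \<open>a\<close>, and move coordinate \<open>j\<close> within its cell of length
  \<open>1 / M\<close> to a zero and to a maximum of the weight.\<close>

lemma oscillating_twist_pair:
  fixes i j :: "'n::finite" and p :: "real ^ 'n"
  assumes "2 \<le> K" "0 \<le> a" "a < 1" "i \<noteq> j" "0 < M" "p \<in> unit_cube"
  shows "\<exists>q\<in>unit_cube. \<exists>q'\<in>unit_cube. norm (q - p) \<le> 1 / K + 1 / M \<and> norm (q' - p) \<le> 1 / K + 1 / M \<and>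
    a \<le> norm (twist i j a K M q - twist i j a K M q')"
proof -
  \<comment> \<open>Clamping to \<open>[1 / K, 1 - 1 / K]\<close>, an interval that is nonempty
    because \<open>2 \<le> K\<close>.\<close>
  define x where "x = max (1 / K) (min (1 - 1 / K) (p $ i))"
  have p: "0 \<le> p $ l" "p $ l \<le> 1" for l
    using assms by (auto simp: unit_cube_def)
  have K: "0 < 1 / K" "1 / K \<le> 1 / 2"
    using assms by (auto simp: field_simps)
  have x: "1 / K \<le> x" "x \<le> 1 - 1 / K" "\<bar>x - p $ i\<bar> \<le> 1 / K" "0 \<le> x" "x \<le> 1"
    unfolding x_def using K p[of i] by linarith+
  \<comment> \<open>The cell \<open>[k / M, (k + 1) / M]\<close> contains \<open>p $ j\<close>; the
    bound \<open>M - 1\<close> keeps it inside \<open>[0,1]\<close> when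
    \<open>p $ j = 1\<close>.\<close>
  define k where "k = min (nat \<lfloor>M * p $ j\<rfloor>) (M - 1)"
  have M: "0 < real M"
    using assms by simp
  have k: "real k \<le> M * p $ j" "M * p $ j \<le> k + 1" "real k + 1 \<le> M"
  proof -
    have nn: "0 \<le> M * p $ j" "M * p $ j \<le> M"
      using p[of j] M by (simp_all add: mult_left_le)
    then have fl: "real (nat \<lfloor>M * p $ j\<rfloor>) \<le> M * p $ j" "M * p $ j \<le> real (nat \<lfloor>M * p $ j\<rfloor>) + 1"
      by linarith+
    show "real k \<le> M * p $ j"
      using fl(1) unfolding k_def by (meson min.cobounded1 of_nat_le_iff order_trans)
    show "M * p $ j \<le> k + 1"
      using fl(2) nn(2) assms by (simp add: k_def min_def of_nat_diff)
    have "k + 1 \<le> M"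
      using assms by (simp add: k_def)
    then show "real k + 1 \<le> M"
      by (metis of_nat_1 of_nat_add of_nat_le_iff)
  qed
  \<comment> \<open>The weight is 0 at \<open>s = 0\<close> and 1 at
    \<open>s = 1 / 2\<close>.\<close>
  define Q where "Q s = (\<chi> l. if l = i then x else if l = j then (k + s) / M else p $ l)" for s :: real
  have Q: "Q s \<in> unit_cube" "norm (Q s - p) \<le> 1 / K + 1 / M" if "0 \<le> s" "s \<le> 1" for s
  proof -
    have "(k + s) / M \<le> 1" "0 \<le> (k + s) / M"
      using that k M by (simp_all add: field_simps)
    then show "Q s \<in> unit_cube"
      using x p by (auto simp: unit_cube_def Q_def)
    have "\<bar>(k + s) - M * p $ j\<bar> \<le> 1"
      using k that by linarith
    moreover have "(k + s) / M - p $ j = ((k + s) - M * p $ j) / M"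
      using M by (simp add: field_simps)
    ultimately have "\<bar>(k + s) / M - p $ j\<bar> \<le> 1 / M"
      using M by (simp add: divide_right_mono)
    moreover have "Q s - p = axis i (x - p $ i) + axis j ((k + s) / M - p $ j)"
      using assms by (simp add: vec_eq_iff axis_def Q_def)
    ultimately show "norm (Q s - p) \<le> 1 / K + 1 / M"
      using x(3) norm_triangle_ineq[of "axis i (x - p $ i)" "axis j ((k + s) / M - p $ j)"]
      by (simp add: norm_axis)
  qed
  have "sin (pi * M * Q 0 $ j) = 0"
    using M assms by (simp add: Q_def mult.commute)
  then have lo: "twist i j a K M (Q 0) $ i = lower a K x"
    by (simp add: twist_def) (simp add: Q_def)
  have "pi * M * Q (1 / 2) $ j = pi * k + pi / 2"
    using M assms by (simp add: Q_def field_simps)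
  then have "(sin (pi * M * Q (1 / 2) $ j))\<^sup>2 = 1"
    by (simp add: sin_add power_even_eq[symmetric] flip: power_mult)
  then have "twist i j a K M (Q (1 / 2)) $ i = lift a K x"
    by (simp add: twist_def) (simp add: Q_def)
  then have "(twist i j a K M (Q (1 / 2)) - twist i j a K M (Q 0)) $ i = a"
    using lo lift_minus_lower[of K a x] x assms by simp
  then have "a \<le> norm (twist i j a K M (Q (1 / 2)) - twist i j a K M (Q 0))"
    by (metis abs_ge_self component_le_norm_cart order_trans)
  then show ?thesis
    using Q[of "1 / 2"] Q[of 0] by force
qed

text \<open>If two images are at least \<open>a\<close> apart, one of them is at least
  \<open>a / 2\<close> from the image of \<open>p\<close>. The amplitude \<open>a\<close> does not
  depend on \<open>r\<close>.\<close>

lemma ex_oscillating_homeomorphism: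
  fixes a r :: real
  assumes "CARD('n::finite) \<ge> 2" "0 \<le> a" "a < 1" "0 < r"
  obtains \<phi> h :: "real ^ 'n \<Rightarrow> real ^ 'n" where "homeomorphism unit_cube unit_cube \<phi> h"
    "\<And>p. p \<in> unit_cube \<Longrightarrow> norm (\<phi> p - p) \<le> a"
    "\<And>p. p \<in> unit_cube \<Longrightarrow> \<exists>q\<in>unit_cube. norm (q - p) < r \<and> a / 2 \<le> norm (\<phi> q - \<phi> p)"
proof -
  obtain i j :: 'n where ij: "i \<noteq> j"
    using assms(1) card_le_Suc0_iff_eq[of "UNIV :: 'n set"] by force
  obtain M where M: "M \<noteq> 0" "inverse (real M) < r / 2" 
    using real_arch_inverse[of "r / 2"] assms by auto
  \<comment> \<open>With this choice both \<open>1 / K\<close> and \<open>1 / M\<close> are below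
    \<open>r / 2\<close>, and \<open>K \<ge> 2\<close> because \<open>M \<noteq> 0\<close>.\<close>
  define K where "K = real (M + 1)"
  have K: "2 \<le> K" "1 / K \<le> inverse (real M)"
    using M by (auto simp: K_def field_simps)
  obtain h :: "real ^ 'n \<Rightarrow> real ^ 'n" where h: "homeomorphism unit_cube unit_cube (twist i j a K M) h"
    using homeomorphism_twist[of K a i j M] K assms ij by auto
  show ?thesis
  proof (rule that[OF h])
    fix p :: "real ^ 'n"
    assume p: "p \<in> unit_cube"
    then show "norm (twist i j a K M p - p) \<le> a"
      using K(1) by (intro twist_displacement assms(2)) auto
    obtain q q' where q: "q \<in> unit_cube" "q' \<in> unit_cube" "norm (q - p) \<le> 1 / K + 1 / M"
      "norm (q' - p) \<le> 1 / K + 1 / M" "a \<le> norm (twist i j a K M q - twist i j a K M q')"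
      using oscillating_twist_pair[of K a i j M p] K(1) assms ij M(1) p by auto
    have "1 / K + 1 / M < r"
      using K M by (simp add: inverse_eq_divide)
    moreover have "a / 2 \<le> norm (twist i j a K M q - twist i j a K M p) \<or>
        a / 2 \<le> norm (twist i j a K M q' - twist i j a K M p)"
      using q(5) norm_triangle_ineq4[of "twist i j a K M q - twist i j a K M p" "twist i j a K M q' - twist i j a K M p"]
      by auto
    ultimately show "\<exists>q\<in>unit_cube. norm (q - p) < r \<and>
        a / 2 \<le> norm (twist i j a K M q - twist i j a K M p)"
      using q by (meson le_less_trans)
  qed
qed

section \<open>Lipschitz estimates at a point\<close>

text \<open>One \<open>n\<close> bounds both the constant and the radius, so countably many
  conditions suffice. With radius \<open>1 / n\<close> the case \<open>n = 0\<close> would hold for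
  every \<open>f\<close>, because \<open>1 / 0 = 0\<close>.\<close>

definition pointwise_lipschitz :: "nat \<Rightarrow> (real ^ 'n \<Rightarrow> real ^ 'n) \<Rightarrow> bool" where
  "pointwise_lipschitz n f \<longleftrightarrow> (\<exists>x\<in>unit_cube. \<forall>y\<in>unit_cube.
     norm (y - x) < 1 / Suc n \<longrightarrow> norm (f y - f x) \<le> n * norm (y - x))"

lemma differentiable_imp_pointwise_lipschitz:
  assumes "x \<in> unit_cube" "f differentiable (at x within unit_cube)"
  shows "\<exists>n. pointwise_lipschitz n f"
proof -
  obtain D where D: "bounded_linear D"
    "\<forall>e>0. \<exists>d>0. \<forall>y\<in>unit_cube. norm (y - x) < d \<longrightarrow> norm (f y - f x - D (y - x)) \<le> e * norm (y - x)"
    using assms(2) unfolding differentiable_def has_derivative_within_alt by blast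
  \<comment> \<open>Tolerance 1 in the definition of the derivative.\<close>
  then obtain d where d: "d > 0"
    "\<And>y. y \<in> unit_cube \<Longrightarrow> norm (y - x) < d \<Longrightarrow> norm (f y - f x - D (y - x)) \<le> norm (y - x)"
    by (metis mult_1 zero_less_one)
  obtain B where B: "\<And>v. norm (D v) \<le> norm v * B"
    using bounded_linear.bounded[OF D(1)] by blast
  \<comment> \<open>\<open>B + 1\<close> is the Lipschitz constant obtained from \<open>D\<close>
    and the tolerance 1; \<open>1 / d\<close> makes the radius at most \<open>d\<close>.\<close>
  obtain n :: nat where n: "max (B + 1) (1 / d) < n"
    using reals_Archimedean2 by blast
  have "norm (f y - f x) \<le> n * norm (y - x)" if y: "y \<in> unit_cube" "norm (y - x) < 1 / Suc n" for y
  proof -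
    have "0 < real n"
      using n d(1) by (smt (verit) divide_pos_pos)
    then have "1 / Suc n \<le> 1 / n"
      by (simp add: frac_le)
    also have "1 / n < d"
      using n d(1) \<open>0 < real n\<close> by (simp add: field_simps)
    finally have "norm (f y - f x - D (y - x)) \<le> norm (y - x)"
      using d(2) y by simp
    then have "norm (f y - f x) \<le> norm (y - x) + norm (y - x) * B"
      using B[of "y - x"] norm_triangle_sub[of "f y - f x" "D (y - x)"] by linarith
    also have "\<dots> = (B + 1) * norm (y - x)"
      by (simp add: algebra_simps)
    also have "\<dots> \<le> n * norm (y - x)"
      using n by (intro mult_right_mono) auto
    finally show ?thesis .
  qed
  then show ?thesis
    unfolding pointwise_lipschitz_def using assms(1) by blast
qed

text \<open>A real supremum dominates its terms only for a set bounded above, which the boundedness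
  of the cube provides.\<close>

lemma norm_le_mdist_Homeo_cube:
  fixes f g :: "real ^ 'n \<Rightarrow> real ^ 'n"
  assumes "f \<in> mspace Homeo_cube" "g \<in> mspace Homeo_cube" "x \<in> unit_cube"
  shows "norm (f x - g x) \<le> mdist Homeo_cube f g"
proof -
  have "bounded (unit_cube :: (real ^ 'n) set)"
    by (simp add: unit_cube_eq_cbox)
  then obtain B where B: "\<And>v :: real ^ 'n. v \<in> unit_cube \<Longrightarrow> norm v \<le> B"
    unfolding bounded_iff by blast
  have "f y \<in> unit_cube" "g y \<in> unit_cube" if "y \<in> unit_cube" for y
    using assms that by (auto simp: mspace_Homeo_cube homeomorphism_def)
  then have "norm (f y - g y) \<le> B + B" if "y \<in> unit_cube" for y
    using B that by (meson add_mono norm_triangle_le_diff)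
  then have "bdd_above ((\<lambda>y. norm (f y - g y)) ` unit_cube)"
    by (intro bdd_aboveI2)
  then show ?thesis
    using assms by (simp add: mdist_Homeo_cube cSUP_upper2[where x = x])
qed

section \<open>Density and category\<close>

lemma ball_without_pointwise_lipschitz:
  fixes f :: "real ^ 'n \<Rightarrow> real ^ 'n"
  assumes "CARD('n::finite) \<ge> 2" "f \<in> mspace Homeo_cube" "0 < e"
  obtains g \<rho> where "g \<in> mspace Homeo_cube" "mdist Homeo_cube f g < e" "0 < \<rho>"
    "\<And>g'. g' \<in> mspace Homeo_cube \<Longrightarrow> mdist Homeo_cube g g' < \<rho> \<Longrightarrow> \<not> pointwise_lipschitz n g'"
proof -
  define a where "a = min (e / 2) (1 / 2)"
  have a: "0 < a" "a < 1" "a < e"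
    using assms(3) by (auto simp: a_def)
  \<comment> \<open>Over a distance below \<open>\<delta>\<close> the estimate allows an increase of
    less than \<open>a / 4\<close>, and \<open>\<delta>\<close> lies within the radius
    \<open>1 / Suc n\<close>.\<close>
  define \<delta> where "\<delta> = a / (4 * Suc n)"
  have "a * real (Suc n) < 1 * real (Suc n)"
    using a by (intro mult_strict_right_mono) auto
  then have \<delta>: "0 < \<delta>" "n * \<delta> < a / 4" "\<delta> < 1 / Suc n"
    using a by (auto simp: \<delta>_def field_simps)
  obtain f' where f': "homeomorphism unit_cube unit_cube f f'"
    using assms(2) by (auto simp: mspace_Homeo_cube)
  have "compact (unit_cube :: (real ^ 'n) set)"
    by (simp add: unit_cube_eq_cbox)
  then have "uniformly_continuous_on unit_cube f'"
    using compact_uniformly_continuous f' homeomorphism_def by blast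
  then obtain r where r: "0 < r"
    "\<And>p q. p \<in> unit_cube \<Longrightarrow> q \<in> unit_cube \<Longrightarrow> norm (q - p) < r \<Longrightarrow> norm (f' q - f' p) < \<delta>"
    using \<delta>(1) unfolding uniformly_continuous_on_def dist_norm by metis
  obtain \<phi> h :: "real ^ 'n \<Rightarrow> real ^ 'n" where \<phi>: "homeomorphism unit_cube unit_cube \<phi> h"
    "\<And>p. p \<in> unit_cube \<Longrightarrow> norm (\<phi> p - p) \<le> a"
    "\<And>p. p \<in> unit_cube \<Longrightarrow> \<exists>q\<in>unit_cube. norm (q - p) < r \<and> a / 2 \<le> norm (\<phi> q - \<phi> p)"
    using ex_oscillating_homeomorphism[OF assms(1), of a r] a r(1) by auto
  \<comment> \<open>The restriction gives the extensional representative that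
    \<open>Homeo_cube\<close> requires.\<close>
  define g where "g = restrict (\<phi> \<circ> f) unit_cube"
  have f_in: "f x \<in> unit_cube" and f'_in: "f' x \<in> unit_cube"
    and f'f: "f' (f x) = x" and ff': "f (f' x) = x" if "x \<in> unit_cube" for x
    using f' that by (auto simp: homeomorphism_def)
  have "homeomorphism unit_cube unit_cube g (f' \<circ> h)"
    using homeomorphism_compose[OF f' \<phi>(1)]
    by (rule homeomorphism_cong) (auto simp: g_def)
  then have g: "g \<in> mspace Homeo_cube"
    by (auto simp: mspace_Homeo_cube g_def)
  have "(0 :: real ^ 'n) \<in> unit_cube"
    by (simp add: unit_cube_def)
  then have ne: "(unit_cube :: (real ^ 'n) set) \<noteq> {}"
    by blast
  have "norm (f x - g x) \<le> a" if "x \<in> unit_cube" for x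
    using \<phi>(2)[OF f_in[OF that]] that by (simp add: g_def norm_minus_commute)
  then have "mdist Homeo_cube f g \<le> a"
    unfolding mdist_Homeo_cube[OF assms(2) g] by (intro cSUP_least ne)
  \<comment> \<open>Radius \<open>a / 8\<close>: replacing \<open>g\<close> by \<open>g'\<close> at
    two points costs less than \<open>a / 4\<close>, the estimate gives less than
    \<open>a / 4\<close>, yet \<open>g\<close> varies by at least \<open>a / 2\<close>.\<close>
  moreover have "\<not> pointwise_lipschitz n g'"
    if g': "g' \<in> mspace Homeo_cube" "mdist Homeo_cube g g' < a / 8" for g'
  proof
    assume "pointwise_lipschitz n g'"
    then obtain x where x: "x \<in> unit_cube" "\<And>y. y \<in> unit_cube \<Longrightarrow> norm (y - x) < 1 / Suc n \<Longrightarrow>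
        norm (g' y - g' x) \<le> n * norm (y - x)"
      unfolding pointwise_lipschitz_def by blast
    obtain q where q: "q \<in> unit_cube" "norm (q - f x) < r" "a / 2 \<le> norm (\<phi> q - \<phi> (f x))"
      using \<phi>(3)[OF f_in[OF x(1)]] by blast
    define y where "y = f' q"
    have y: "y \<in> unit_cube" "f y = q"
      using q f'_in ff' by (auto simp: y_def)
    have "norm (y - x) < \<delta>"
      using r(2)[OF f_in[OF x(1)] q(1,2)] f'f[OF x(1)] by (simp add: y_def)
    then have "norm (g' y - g' x) \<le> n * norm (y - x)" "n * norm (y - x) \<le> n * \<delta>"
      using x(2)[OF y(1)] \<delta>(3) by (auto intro: mult_left_mono)
    then have "norm (g' y - g' x) < a / 4"
      using \<delta>(2) by linarith
    moreover have "norm (g y - g' y) < a / 8" "norm (g x - g' x) < a / 8"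
      using norm_le_mdist_Homeo_cube[OF g g'(1)] g'(2) x(1) y(1) by (meson le_less_trans)+
    moreover have "norm (g y - g x) \<le> norm (g y - g' y) + norm (g' y - g' x) + norm (g x - g' x)"
      by norm
    moreover have "a / 2 \<le> norm (g y - g x)"
      using q(3) x(1) y by (simp add: g_def)
    ultimately show False
      by linarith
  qed
  ultimately show ?thesis
    using that[of g "a / 8"] g a by auto
qed

text \<open>If a ball around \<open>f\<close> lay in the closure of \<open>S\<close>, its point
  \<open>g\<close> would be a limit of points of \<open>S\<close>, but a whole ball around
  \<open>g\<close> misses \<open>S\<close>.\<close>

lemma nowhere_dense_inI_metric:
  assumes "S \<subseteq> mspace m"
    and "\<And>f e. f \<in> mspace m \<Longrightarrow> 0 < e \<Longrightarrow> \<exists>g\<in>mspace m. \<exists>\<rho>>0. mdist m f g < e \<and> (\<forall>g'\<in>S. \<not> mdist m g g' < \<rho>)"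
  shows "nowhere_dense_in (mtopology_of m) S"
proof -
  interpret Metric_space "mspace m" "mdist m"
    by simp
  have False if f: "f \<in> mtopology interior_of (mtopology closure_of S)" for f
  proof -
    obtain U where U: "openin mtopology U" "f \<in> U" "U \<subseteq> mtopology closure_of S"
      using f by (auto simp: interior_of_def)
    then obtain e where e: "0 < e" "mball f e \<subseteq> U"
      by (auto simp: openin_mtopology)
    have fm: "f \<in> mspace m"
      using U by (auto simp: openin_mtopology)
    then obtain g \<rho> where g: "g \<in> mspace m" "0 < \<rho>" "mdist m f g < e" "\<forall>g'\<in>S. \<not> mdist m g g' < \<rho>"
      using assms(2) e(1) by blast
    then have "g \<in> mtopology closure_of S"
      using e U fm by auto
    then obtain g' where "g' \<in> S" "g' \<in> mball g \<rho>"
      using g(2) by (auto simp: metric_closure_of)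
    then show False
      using g(4) by auto
  qed
  then show ?thesis
    using assms(1) by (auto simp: nowhere_dense_in_def mtopology_of_def)
qed

theorem theorem4p1:
  assumes "CARD('n::finite) \<ge> 2"
  shows "comeager_in (mtopology_of (Homeo_cube :: (real ^ 'n \<Rightarrow> real ^ 'n) metric))
           {f \<in> mspace Homeo_cube. \<forall>x\<in>unit_cube. \<not> f differentiable (at x within unit_cube)}"
proof -
  define D :: "(real ^ 'n \<Rightarrow> real ^ 'n) set" where
    "D = {f \<in> mspace Homeo_cube. \<exists>x\<in>unit_cube. f differentiable (at x within unit_cube)}"
  \<comment> \<open>Intersecting with \<open>D\<close> makes the union equal to \<open>D\<close>, as
    \<open>meager_in\<close> demands; a subset of \<open>D\<close> suffices for nowhere
    density.\<close>
  define N where "N n = {f \<in> D. pointwise_lipschitz n f}" for n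
  have "nowhere_dense_in (mtopology_of Homeo_cube) (N n)" for n
  proof (rule nowhere_dense_inI_metric)
    show "N n \<subseteq> mspace Homeo_cube"
      by (auto simp: N_def D_def)
    fix f :: "real ^ 'n \<Rightarrow> real ^ 'n" and e :: real
    assume "f \<in> mspace Homeo_cube" "0 < e"
    then obtain g \<rho> where g: "g \<in> mspace Homeo_cube" "mdist Homeo_cube f g < e" "0 < \<rho>"
      "\<And>g'. g' \<in> mspace Homeo_cube \<Longrightarrow> mdist Homeo_cube g g' < \<rho> \<Longrightarrow> \<not> pointwise_lipschitz n g'"
      by (rule ball_without_pointwise_lipschitz[OF assms, where n = n]) blast
    have "\<forall>g'\<in>N n. \<not> mdist Homeo_cube g g' < \<rho>"
      using g(4) unfolding N_def D_def by blast
    with g(1-3) show "\<exists>g\<in>mspace Homeo_cube. \<exists>\<rho>>0. mdist Homeo_cube f g < e \<and> (\<forall>g'\<in>N n. \<not> mdist Homeo_cube g g' < \<rho>)"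
      by blast
  qed
  moreover have "D = \<Union> (range N)"
  proof -
    have "\<exists>n. pointwise_lipschitz n f" if "f \<in> D" for f
      using that differentiable_imp_pointwise_lipschitz unfolding D_def by blast
    then show ?thesis
      unfolding N_def by blast
  qed
  ultimately have "meager_in (mtopology_of Homeo_cube) D"
    unfolding meager_in_def by (intro exI[of _ "range N"]) simp
  moreover have "mspace Homeo_cube - {f \<in> mspace Homeo_cube. \<forall>x\<in>unit_cube. \<not> f differentiable (at x within unit_cube)} = D"
    unfolding D_def by blast
  ultimately show ?thesis
    unfolding comeager_in_def topspace_mtopology_of by simp
qed

end
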